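(* Let $\phi(t)=\sum_{n=0}^\infty t^n\sum_{k=0}^n\binom nk^2\binom{n+k}{k}$. Then for $|k|$ sufficiently small: \[\phi\!\left(k\left(\frac{1-k}{1+k}\right)^2\right)=\frac{(1+k)^2}{\sqrt{(1+k^2)\left((1-k-k^2)^2-5k^2\right)}}\ {}_2F_1\!\left(\frac14,\frac34;1;\frac{64k^5(1+k-k^2)}{(1+k^2)^2\left((1-k-k^2)^2-5k^2\right)^2}\right),\] \[\phi\!\left(k^2\,\frac{1+k}{1-k}\right)=\frac{1-k}{\sqrt{(1+k^2)\left((1+11k-k^2)^2-125k^2\right)}}\ {}_2F_1\!\left(\frac14,\frac34;1;\frac{64k(1+k-k^2)^5}{(1+k^2)^2\left((1+11k-k^2)^2-125k^2\right)^2}\right),\] and \[\phi\!\left(k^2\,\frac{1+k}{1-k}\right)=\frac{1-k}{(1+k)^2}\,\phi\!\left(k\left(\frac{1-k}{1+k}\right)^2\right).\]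
   Context: ${}_2F_1$ denotes the Gauss hypergeometric function; square roots are the principal branches (equal to $1$ at $k=0$). *)

theory Defs
  imports "HOL-Analysis.Analysis"
begin

definition apery_coeff :: "nat \<Rightarrow> nat" where
  "apery_coeff n = (\<Sum>k=0..n. (n choose k)^2 * ((n + k) choose k))"

definition phi :: "complex \<Rightarrow> complex" where
  "phi t = (\<Sum>n. of_nat (apery_coeff n) * t ^ n)"

definition hyp2F1 :: "complex \<Rightarrow> complex \<Rightarrow> complex \<Rightarrow> complex \<Rightarrow> complex" where
  "hyp2F1 a b c z =
     (\<Sum>n. pochhammer a n * pochhammer b n / (pochhammer c n * fact n) * z ^ n)"

end

theory Submission
  imports Defs
begin

text \<open>
  The four functions
  \<open>\<phi>(k((1-k)/(1+k))\<^sup>2) / (1+k)\<^sup>2\<close>, \<open>\<phi>(k\<^sup>2(1+k)/(1-k)) / (1-k)\<close> and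
  \<open>D\<^sup>-\<^sup>1\<^sup>/\<^sup>2 \<cdot> \<^sub>2F\<^sub>1(1/4, 3/4; 1; X)\<close>, for the two pairs \<open>(D, X)\<close>
  in the theorem, all solve one and the same equation \<open>(p y')' = q y\<close> with \<open>p = k(1-k\<^sup>2)(1-4k-k\<^sup>2)(1+k-k\<^sup>2)\<close> and \<open>q\<close> a polynomial.
  Since \<open>p\<close> vanishes at \<open>0\<close>, the quantity \<open>p\<close> times the Wronskian of two solutions, which is
  constant, is zero. So a solution that is regular at \<open>0\<close> is determined by its value there, which is
  \<open>1\<close> in all four cases. The equation is pulled back from the equations
  \<open>(t(1-11t-t\<^sup>2) \<phi>')' = (3+t) \<phi>\<close> and \<open>(z(1-z) F')' = 3/16 F\<close>.
\<close>

section \<open>Equations \<open>(p f')' = q f\<close> near a zero of \<open>p\<close>: uniqueness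
  and change of variable\<close>

lemma eventually_nhds_0_ne:
  fixes g :: "complex \<Rightarrow> complex"
  assumes "isCont g 0" "g 0 \<noteq> 0"
  shows "\<forall>\<^sub>F k in nhds 0. g k \<noteq> 0"
  using assms by (simp add: continuous_at tendsto_imp_eventually_ne eventually_nhds_conv_at)

text \<open>The prefix stands for Sturm-Liouville. The second condition differentiates the product
  \<open>p * f'\<close> and so asks for no second derivative of \<open>f\<close>. Both conditions
  hold on a full neighbourhood of \<open>0\<close>, even where \<open>p\<close> vanishes at
  \<open>0\<close>; this singles out the solutions that are regular there.\<close>

definition sl_solution :: "(complex \<Rightarrow> complex) \<Rightarrow> (complex \<Rightarrow> complex) \<Rightarrow> (complex \<Rightarrow> complex) \<Rightarrow> bool"
  where "sl_solution p q f \<longleftrightarrow> (\<exists>f'. \<forall>\<^sub>F z in nhds 0.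
     (f has_field_derivative f' z) (at z) \<and>
     ((\<lambda>z. p z * f' z) has_field_derivative q z * f z) (at z))"

text \<open>In the derivative of \<open>p * (f' * g - f * g')\<close> the terms
  \<open>q * f * g\<close> cancel, and so do the terms \<open>p * f' * g'\<close>. Its constant
  value is the one at \<open>0\<close>, where \<open>p\<close> vanishes. Away from \<open>0\<close>
  one may divide by \<open>p\<close>, so \<open>f / g\<close> has derivative zero.\<close>

lemma sl_solution_unique:
  assumes f: "sl_solution p q f" and g: "sl_solution p q g"
  assumes p: "p 0 = 0" "\<forall>\<^sub>F z in at 0. p z \<noteq> 0"
  assumes "f 0 = g 0" "g 0 \<noteq> 0"
  shows "\<forall>\<^sub>F z in nhds 0. f z = g z"
proof -
  from f obtain f' where f': "\<forall>\<^sub>F z in nhds 0. (f has_field_derivative f' z) (at z) \<and>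
     ((\<lambda>z. p z * f' z) has_field_derivative q z * f z) (at z)"
    unfolding sl_solution_def by blast
  from g obtain g' where g': "\<forall>\<^sub>F z in nhds 0. (g has_field_derivative g' z) (at z) \<and>
     ((\<lambda>z. p z * g' z) has_field_derivative q z * g z) (at z)"
    unfolding sl_solution_def by blast
  from g' have "isCont g 0"
    by (auto dest!: eventually_nhds_x_imp_x intro: DERIV_isCont)
  hence g0: "\<forall>\<^sub>F z in nhds 0. g z \<noteq> 0"
    using \<open>g 0 \<noteq> 0\<close> by (rule eventually_nhds_0_ne)
  have "\<forall>\<^sub>F z in nhds 0. z \<noteq> 0 \<longrightarrow> p z \<noteq> 0"
    using p(2) by (simp add: eventually_at_filter)
  from eventually_conj[OF this eventually_conj[OF g0 eventually_conj[OF f' g']]]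
  obtain e where e: "e > 0" and
    *: "\<And>z. dist z 0 < e \<Longrightarrow> (z \<noteq> 0 \<longrightarrow> p z \<noteq> 0) \<and> g z \<noteq> 0 \<and>
        ((f has_field_derivative f' z) (at z) \<and>
        ((\<lambda>z. p z * f' z) has_field_derivative q z * f z) (at z)) \<and>
        ((g has_field_derivative g' z) (at z) \<and>
        ((\<lambda>z. p z * g' z) has_field_derivative q z * g z) (at z))"
    unfolding eventually_nhds_metric by blast
  let ?B = "ball 0 e"
  have dist: "dist z 0 < e" if "z \<in> ?B" for z using that by (simp add: dist_commute)
  define W where "W z = p z * f' z * g z - f z * (p z * g' z)" for z
  have "(W has_field_derivative 0) (at z)" if "z \<in> ?B" for z
  proof -
    have D: "(f has_field_derivative f' z) (at z)"
            "((\<lambda>z. p z * f' z) has_field_derivative q z * f z) (at z)"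
            "(g has_field_derivative g' z) (at z)"
            "((\<lambda>z. p z * g' z) has_field_derivative q z * g z) (at z)"
      using *[OF dist[OF that]] by auto
    show ?thesis
      unfolding W_def
      using DERIV_diff[OF DERIV_mult[OF D(2,3)] DERIV_mult[OF D(1,4)]]
      by (rule DERIV_cong) (simp add: algebra_simps)
  qed
  then obtain c where c: "\<And>z. z \<in> ?B \<Longrightarrow> W z = c"
    using has_field_derivative_0_imp_constant_on[of ?B W] by (auto simp: constant_on_def)
  have W0: "W z = 0" if "z \<in> ?B" for z
    using c[OF that] c[of 0] e by (simp add: W_def p(1))
  have "continuous_on ?B f" "continuous_on ?B g"
    using *[OF dist] by (meson DERIV_isCont continuous_at_imp_continuous_on)+
  hence "continuous_on ?B (\<lambda>z. f z / g z)"
    using *[OF dist] by (intro continuous_on_divide) auto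
  moreover have "((\<lambda>z. f z / g z) has_field_derivative 0) (at z)" if "z \<in> ?B - {0}" for z
  proof -
    from that have z: "z \<in> ?B" "z \<noteq> 0" by auto
    have "f' z * g z - f z * g' z = 0"
      using W0[OF z(1)] *[OF dist[OF z(1)]] z(2) by (auto simp: W_def algebra_simps)
    thus ?thesis
      using *[OF dist[OF z(1)]] by (auto intro!: derivative_eq_intros)
  qed
  \<comment> \<open>The derivative of \<open>f / g\<close> is controlled only off the singular
    point; continuity carries the constant across the exceptional set \<open>{0}\<close>.\<close>
  ultimately obtain c' where c': "\<And>z. z \<in> ?B \<Longrightarrow> f z / g z = c'"
    using DERIV_zero_connected_constant[of ?B "{0}" "\<lambda>z. f z / g z"] by auto
  have "f z = g z" if "dist z 0 < e" for z
    using c'[of z] c'[of 0] that e *[OF that] assms(5,6) by (auto simp: dist_commute)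
  thus ?thesis
    unfolding eventually_nhds_metric using e by blast
qed

text \<open>
  Here \<open>\<sigma> = s'/s\<close>. The assumption on \<open>P\<close> makes \<open>P (s \<cdot> f \<circ> X)' = P \<sigma> s (f \<circ> X) + c (p f') \<circ> X / s\<close>,
  so that the terms with \<open>f'\<close> cancel in its derivative; the assumption on \<open>Q\<close> collects
  what remains.
\<close>

lemma sl_solution_pullback:
  assumes f: "sl_solution p q f"
  assumes R: "\<forall>\<^sub>F k in nhds 0. R k"
  assumes X: "X 0 = 0" "\<And>k. R k \<Longrightarrow> (X has_field_derivative X' k) (at k)"
  assumes s: "\<And>k. R k \<Longrightarrow> s k \<noteq> 0" "\<And>k. R k \<Longrightarrow> (s has_field_derivative \<sigma> k * s k) (at k)"
  assumes M: "\<And>k. R k \<Longrightarrow> ((\<lambda>k. P k * \<sigma> k) has_field_derivative M k) (at k)"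
  assumes P: "\<And>k. R k \<Longrightarrow> P k * X' k * s k ^ 2 = c * p (X k)"
  assumes Q: "\<And>k. R k \<Longrightarrow> Q k = M k + P k * \<sigma> k ^ 2 + c * q (X k) * X' k / s k ^ 2"
  shows "sl_solution P Q (\<lambda>k. s k * f (X k))"
proof -
  from f obtain f' where f': "\<forall>\<^sub>F z in nhds 0. (f has_field_derivative f' z) (at z) \<and>
     ((\<lambda>z. p z * f' z) has_field_derivative q z * f z) (at z)"
    unfolding sl_solution_def by blast
  from R have "R 0" by (rule eventually_nhds_x_imp_x)
  hence "isCont X 0" using X(2) by (blast intro: DERIV_isCont)
  hence "filterlim X (nhds 0) (nhds 0)"
    using X(1) by (simp add: tendsto_nhds_iff continuous_at)
  from this f' have f'': "\<forall>\<^sub>F k in nhds 0. (f has_field_derivative f' (X k)) (at (X k)) \<and>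
     ((\<lambda>z. p z * f' z) has_field_derivative q (X k) * f (X k)) (at (X k))"
    by (rule eventually_compose_filterlim[rotated])
  define y' where "y' k = \<sigma> k * s k * f (X k) + s k * (f' (X k) * X' k)" for k
  \<comment> \<open>In \<open>V\<close> the derivative of \<open>f\<close> enters only through
    \<open>p * f'\<close>, whose derivative is known.\<close>
  define V where "V k = (P k * \<sigma> k) * (s k * f (X k)) + c * (p (X k) * f' (X k)) / s k" for k
  have V: "\<forall>\<^sub>F k in nhds 0. P k * y' k = V k"
    using R
  proof eventually_elim
    case (elim k)
    have "P k * (s k * (f' (X k) * X' k)) = (P k * X' k * s k ^ 2) * f' (X k) / s k"
      using s(1)[OF elim] by (simp add: power2_eq_square)
    also have "\<dots> = c * (p (X k) * f' (X k)) / s k"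
      using P[OF elim] by simp
    finally show ?case by (simp add: y'_def V_def ring_distribs)
  qed
  \<comment> \<open>To transfer a derivative from \<open>V\<close> to \<open>P * y'\<close> at a
    point \<open>k\<close>, the two must agree near \<open>k\<close> and not just at
    \<open>k\<close>.\<close>
  hence V': "\<forall>\<^sub>F k in nhds 0. \<forall>\<^sub>F k in nhds k. P k * y' k = V k"
    by (simp add: eventually_eventually)
  have "\<forall>\<^sub>F k in nhds 0. ((\<lambda>k. s k * f (X k)) has_field_derivative y' k) (at k) \<and>
     ((\<lambda>k. P k * y' k) has_field_derivative Q k * (s k * f (X k))) (at k)"
    using f'' R V'
  proof eventually_elim
    case (elim k)
    note k = \<open>R k\<close>
    have fX: "((\<lambda>k. f (X k)) has_field_derivative f' (X k) * X' k) (at k)"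
      using elim(1) X(2)[OF k] by (auto intro: DERIV_chain2)
    have pX: "((\<lambda>k. p (X k) * f' (X k)) has_field_derivative q (X k) * f (X k) * X' k) (at k)"
      using DERIV_chain2[of "\<lambda>z. p z * f' z" _ X k] elim(1) X(2)[OF k] by auto
    have 1: "((\<lambda>k. s k * f (X k)) has_field_derivative y' k) (at k)"
      using s(2)[OF k] by (auto intro!: derivative_eq_intros fX simp: y'_def)
    have "(V has_field_derivative
            M k * (s k * f (X k)) + P k * \<sigma> k * y' k
            + (c * (q (X k) * f (X k) * X' k) / s k
               - c * (p (X k) * f' (X k)) * (\<sigma> k * s k) / s k ^ 2)) (at k)"
      unfolding V_def
      using DERIV_add[OF DERIV_mult[OF M[OF k] 1]
              DERIV_divide[OF DERIV_cmult[OF pX] s(2)[OF k] s(1)[OF k]]]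
      by (rule DERIV_cong) (use s(1)[OF k] in \<open>simp add: diff_divide_distrib power2_eq_square\<close>)
    also have "M k * (s k * f (X k)) + P k * \<sigma> k * y' k
            + (c * (q (X k) * f (X k) * X' k) / s k
               - c * (p (X k) * f' (X k)) * (\<sigma> k * s k) / s k ^ 2) = Q k * (s k * f (X k))"
    proof -
      \<comment> \<open>This is the term that the quotient rule produces from differentiating
        \<open>1 / s\<close>. In this form it cancels the part of \<open>P * \<sigma> * y'\<close>
        that contains \<open>f'\<close>.\<close>
      have "c * (p (X k) * f' (X k)) * (\<sigma> k * s k) / s k ^ 2
              = P k * X' k * f' (X k) * \<sigma> k * s k"
        using s(1)[OF k] by (simp add: mult.assoc[symmetric] P[OF k, symmetric])
      from s(1)[OF k] show ?thesis
        unfolding \<open>c * _ * _ / _ = _\<close> Q[OF k] y'_def by (simp add: field_simps power2_eq_square)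
    qed
    finally have "((\<lambda>k. P k * y' k) has_field_derivative Q k * (s k * f (X k))) (at k)"
      using elim(3) by (subst DERIV_cong_ev[OF refl _ refl]) auto
    with 1 show ?case by blast
  qed
  thus ?thesis
    unfolding sl_solution_def by blast
qed

section \<open>Solutions given by power series\<close>

text \<open>Evaluation commutes with derivatives and products inside the disc of convergence, so a
  formal identity, that is, a recurrence for the coefficients, becomes an analytic one.\<close>

lemma sl_solution_eval_fps:
  fixes F :: "complex fps"
  assumes r: "fps_conv_radius F > 0"
  assumes ode: "fps_deriv (fps_of_poly p * fps_deriv F) = fps_of_poly q * F"
  shows "sl_solution (poly p) (poly q) (eval_fps F)"
proof -
  let ?R = "fps_conv_radius F"
  have r1: "?R \<le> fps_conv_radius (fps_deriv F)"
    by (rule fps_conv_radius_deriv)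
  \<comment> \<open>A polynomial has infinite radius of convergence, so the product converges at
    least where \<open>F\<close> does.\<close>
  have "min \<infinity> (fps_conv_radius (fps_deriv F)) \<le> fps_conv_radius (fps_of_poly p * fps_deriv F)"
    using fps_conv_radius_mult[of "fps_of_poly p" "fps_deriv F"] by simp
  hence r2: "?R \<le> fps_conv_radius (fps_of_poly p * fps_deriv F)"
    using r1 by (auto simp: min_def split: if_splits)
  have "(eval_fps F has_field_derivative eval_fps (fps_deriv F) z) (at z) \<and>
        ((\<lambda>z. poly p z * eval_fps (fps_deriv F) z) has_field_derivative
          poly q z * eval_fps F z) (at z)"
    if z: "z \<in> eball 0 ?R" for z
  proof
    from z have z': "ereal (norm z) < ?R" by simp
    thus "(eval_fps F has_field_derivative eval_fps (fps_deriv F) z) (at z)"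
      by (rule has_field_derivative_eval_fps)
    have "(eval_fps (fps_of_poly p * fps_deriv F) has_field_derivative
            eval_fps (fps_deriv (fps_of_poly p * fps_deriv F)) z) (at z)"
      using z' r2 by (intro has_field_derivative_eval_fps) (auto intro: less_le_trans)
    also have "eval_fps (fps_deriv (fps_of_poly p * fps_deriv F)) z = poly q z * eval_fps F z"
      using z' by (simp add: ode eval_fps_mult del: fps_deriv_mult)
    finally show "((\<lambda>z. poly p z * eval_fps (fps_deriv F) z) has_field_derivative
          poly q z * eval_fps F z) (at z)"
    proof (rule has_field_derivative_transform_within_open[OF _ open_eball z])
      fix w :: complex assume "w \<in> eball 0 ?R"
      hence "ereal (norm w) < fps_conv_radius (fps_deriv F)"
        using r1 by (auto intro: less_le_trans)
      thus "eval_fps (fps_of_poly p * fps_deriv F) w = poly p w * eval_fps (fps_deriv F) w"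
        by (simp add: eval_fps_mult)
    qed
  qed
  moreover have "\<forall>\<^sub>F z in nhds 0. z \<in> eball 0 ?R"
    using r by (intro eventually_nhds_in_open) (auto simp: zero_ereal_def)
  ultimately show ?thesis
    unfolding sl_solution_def by (blast intro: eventually_mono)
qed

lemma fps_conv_radius_pos:
  fixes a :: "nat \<Rightarrow> complex"
  assumes "C > 0" "\<And>n. norm (a n) \<le> C ^ n"
  shows "fps_conv_radius (Abs_fps a) > 0"
proof -
  \<comment> \<open>At this point the terms are dominated by \<open>(1/2) ^ n\<close>, which gives
    the radius a positive lower bound.\<close>
  define z :: complex where "z = of_real (1 / (2 * C))"
  have z: "norm z = 1 / (2 * C)" using assms(1) unfolding z_def norm_of_real by simp
  have "summable (\<lambda>n. a n * z ^ n)"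
  proof (rule summable_comparison_test')
    show "summable (\<lambda>n. (1 / 2 :: real) ^ n)" by (rule summable_geometric) simp
    fix n :: nat
    have "norm (a n * z ^ n) \<le> C ^ n * (1 / (2 * C)) ^ n"
      unfolding norm_mult norm_power z using assms by (intro mult_right_mono) auto
    also have "\<dots> = (1 / 2) ^ n"
      using assms(1) by (simp flip: power_mult_distrib)
    finally show "norm (a n * z ^ n) \<le> (1 / 2) ^ n" .
  qed
  hence "ereal (norm z) \<le> fps_conv_radius (Abs_fps a)"
    unfolding fps_conv_radius_def by (intro conv_radius_geI) simp
  moreover have "0 < ereal (norm z)" using assms(1) z by simp
  ultimately show ?thesis by (rule less_le_trans[rotated])
qed

section \<open>The three-term recurrence of the Apery numbers for \<open>\<zeta>(2)\<close>\<close>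

definition apery_term :: "nat \<Rightarrow> nat \<Rightarrow> real" where
  "apery_term n k = real ((n choose k)^2 * ((n + k) choose k))"

lemma apery_term_eq_0: "n < k \<Longrightarrow> apery_term n k = 0"
  by (simp add: apery_term_def)

text \<open>Writing the upper index as \<open>k + j\<close> avoids truncated subtraction. In
  factorial form, neighbouring terms differ by rational factors only.\<close>

lemma apery_term_add:
  "apery_term (k + j) k = fact (k + j) * fact (2 * k + j) / (fact k ^ 3 * fact j ^ 2)"
proof -
  have "real ((k + j) choose k) = fact (k + j) / (fact k * fact j)"
    by (subst binomial_fact) auto
  moreover have "real ((k + j + k) choose k) = fact (2 * k + j) / (fact k * fact (k + j))"
    by (subst binomial_fact) (auto simp: algebra_simps mult_2 simp flip: mult_2_right)
  ultimately show ?thesis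
    unfolding apery_term_def of_nat_mult of_nat_power
    by (simp only:) (simp add: field_simps power2_eq_square power3_eq_cube)
qed

text \<open>The multiplier is the Wilf--Zeilberger certificate of the Apery recurrence for \<open>\<zeta>(2)\<close>.\<close>

definition apery_cert :: "nat \<Rightarrow> nat \<Rightarrow> real" where
  "apery_cert n k =
     (real k ^ 2 + 3 * (2 * real n + 1) * real k - 11 * real n ^ 2 - 9 * real n - 2) * apery_term n k"

text \<open>After division by a common hypergeometric factor \<open>u\<close> the claim is a
  polynomial identity. The cases reflect the support of the terms: for \<open>k = n + 1\<close> and
  \<open>k = n\<close> some of them vanish and the factorial formula does not apply to them.\<close>

lemma apery_term_telescope:
  assumes "n > 0" "k > 0" "k \<le> n + 1"
  shows "(real n + 1)^2 * apery_term (n + 1) k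
           - (11 * real n ^ 2 + 11 * real n + 3) * apery_term n k
           - real n ^ 2 * apery_term (n - 1) k
         = apery_cert n k - apery_cert n (k - 1)"
proof -
  obtain i where k: "k = i + 1"
    using assms by (metis Suc_eq_plus1 gr0_implies_Suc)
  define x where "x = real i"
  have [simp]: "x + 1 \<noteq> 0" "1 + x \<noteq> 0" unfolding x_def by auto
  have fi: "fact (i + 1) = (x + 1) * fact i"
    by (simp add: x_def)
  consider "k = n + 1" | "k = n" | j where "n = k + j + 1"
    using assms
    by (metis Suc_eq_plus1 less_iff_Suc_add le_antisym not_less_eq_eq nat_less_le)
  thus ?thesis
  proof cases
    case 1
    \<comment> \<open>The smallest numerator factorials over the largest denominator among the
      nonzero terms, so that each of these is a polynomial times \<open>u\<close>. The other two
      cases choose \<open>u\<close> in the same way.\<close>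
    define u where "u = fact i * fact (2 * i) / ((x + 1) * fact i) ^ 3"
    have fb: "fact (2 * i + 2) = (2 * x + 2) * (2 * x + 1) * fact (2 * i)"
      by (simp add: x_def algebra_simps)
    have t1: "apery_term (n + 1) k = (x + 1) * (2 * x + 2) * (2 * x + 1) * u"
    proof -
      have e: "n + 1 = k + 0" "k + 0 = i + 1" "2 * k + 0 = 2 * i + 2"
        using 1 k by auto
      show ?thesis
        unfolding e(1) apery_term_add unfolding e(2,3) unfolding k fi fb u_def by simp
    qed
    have t2: "apery_term n i = (x + 1) ^ 3 * u"
      using apery_term_add[of i 0] 1 k by (simp add: u_def power_mult_distrib)
    have t3: "apery_term n k = 0" "apery_term (n - 1) k = 0"
      using 1 by (auto intro: apery_term_eq_0)
    have n: "real n = x" "real k = x + 1" "k - 1 = i" "real i = x"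
      using 1 k by (auto simp: x_def)
    show ?thesis
      unfolding apery_cert_def n t1 t2 t3 by algebra
  next
    case 2
    define u where "u = fact i * fact (2 * i + 1) / ((x + 1) * fact i) ^ 3"
    have fa: "fact (i + 2) = (x + 2) * (x + 1) * fact i"
      by (simp add: x_def algebra_simps)
    have fb: "fact (2 * i + 2) = (2 * x + 2) * fact (2 * i + 1)"
             "fact (2 * i + 3) = (2 * x + 3) * (2 * x + 2) * fact (2 * i + 1)"
      by (simp_all add: x_def algebra_simps numeral_3_eq_3 numeral_2_eq_2)
    have t1: "apery_term (n + 1) k = (x + 2) * (x + 1) * (2 * x + 3) * (2 * x + 2) * u"
    proof -
      have e: "n + 1 = k + 1" "k + 1 = i + 2" "2 * k + 1 = 2 * i + 3"
        using 2 k by auto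
      show ?thesis
        unfolding e(1) apery_term_add unfolding e(2,3) unfolding k fi fa fb u_def by simp
    qed
    have t2: "apery_term n k = (x + 1) * (2 * x + 2) * u"
    proof -
      have e: "n = k + 0" "k + 0 = i + 1" "2 * k + 0 = 2 * i + 2"
        using 2 k by auto
      show ?thesis
        unfolding e(1) apery_term_add unfolding e(2,3) unfolding k fi fa fb u_def by simp
    qed
    have t3: "apery_term n i = (x + 1) ^ 4 * u"
    proof -
      have e: "n = i + 1" using 2 k by auto
      show ?thesis
        unfolding e apery_term_add fi u_def
        by (simp add: power_mult_distrib power_numeral_reduce)
    qed
    have t4: "apery_term (n - 1) k = 0"
      using 2 assms by (intro apery_term_eq_0) auto
    have n: "real n = x + 1" "real k = x + 1" "k - 1 = i" "real i = x"
      using 2 k by (auto simp: x_def)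
    show ?thesis
      unfolding apery_cert_def n t1 t2 t3 t4 by algebra
  next
    case (3 j)
    define y where "y = real j"
    define u where "u = fact (i + j + 1) * fact (2 * i + j + 2)
                          / (((x + 1) * fact i) ^ 3 * ((y + 2) * (y + 1) * fact j) ^ 2)"
    have [simp]: "1 + y \<noteq> 0" "2 + y \<noteq> 0" "y + 1 \<noteq> 0" "y + 2 \<noteq> 0" unfolding y_def by auto
    have fj: "fact (j + 1) = (y + 1) * fact j" "fact (j + 2) = (y + 2) * (y + 1) * fact j"
      by (simp_all add: y_def algebra_simps)
    have fa: "fact (i + j + 2) = (x + y + 2) * fact (i + j + 1)"
             "fact (i + j + 3) = (x + y + 3) * (x + y + 2) * fact (i + j + 1)"
      by (simp_all add: x_def y_def algebra_simps numeral_3_eq_3 numeral_2_eq_2)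
    have fb: "fact (2 * i + j + 3) = (2 * x + y + 3) * fact (2 * i + j + 2)"
             "fact (2 * i + j + 4) = (2 * x + y + 4) * (2 * x + y + 3) * fact (2 * i + j + 2)"
      by (simp_all add: x_def y_def algebra_simps eval_nat_numeral)
    have t1: "apery_term (n + 1) k
              = (x + y + 3) * (x + y + 2) * (2 * x + y + 4) * (2 * x + y + 3) * u"
    proof -
      have e: "n + 1 = k + (j + 2)" "k + (j + 2) = i + j + 3" "2 * k + (j + 2) = 2 * i + j + 4"
        using 3 k by auto
      show ?thesis
        unfolding e(1) apery_term_add unfolding e(2,3) unfolding k fi fj fa fb u_def by (simp add: ac_simps del: fact_Suc)
    qed
    have t2: "apery_term n k = (x + y + 2) * (2 * x + y + 3) * (y + 2) ^ 2 * u"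
    proof -
      have e: "n = k + (j + 1)" "k + (j + 1) = i + j + 2" "2 * k + (j + 1) = 2 * i + j + 3"
        using 3 k by auto
      show ?thesis
        unfolding e(1) apery_term_add unfolding e(2,3) unfolding k fi fj fa fb u_def
        by (simp add: power_mult_distrib ac_simps del: fact_Suc)
    qed
    have t3: "apery_term (n - 1) k = ((y + 2) * (y + 1)) ^ 2 * u"
    proof -
      have e: "n - 1 = k + j" "k + j = i + j + 1" "2 * k + j = 2 * i + j + 2"
        using 3 k by auto
      show ?thesis
        unfolding e(1) apery_term_add unfolding e(2,3) unfolding k fi fj fa fb u_def
        by (simp add: power_mult_distrib ac_simps del: fact_Suc)
    qed
    have t4: "apery_term n i = (x + y + 2) * (x + 1) ^ 3 * u"
    proof -
      have e: "n = i + (j + 2)" "i + (j + 2) = i + j + 2" "2 * i + (j + 2) = 2 * i + j + 2"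
        using 3 k by auto
      show ?thesis
        unfolding e(1) apery_term_add unfolding e(2,3) fi fj fa fb u_def
        by (simp add: power_mult_distrib ac_simps del: fact_Suc)
    qed
    have n: "real n = x + y + 2" "real k = x + 1" "k - 1 = i" "real i = x"
      using 3 k by (auto simp: x_def y_def)
    show ?thesis
      unfolding apery_cert_def n t1 t2 t3 t4 by algebra
  qed
qed

text \<open>The summand vanishes for \<open>k > n\<close>, so the sums for \<open>n - 1\<close>,
  \<open>n\<close> and \<open>n + 1\<close> can share one range.\<close>

lemma apery_coeff_eq_sum:
  assumes "n \<le> m"
  shows "real (apery_coeff n) = (\<Sum>k\<le>m. apery_term n k)"
proof -
  have "real (apery_coeff n) = (\<Sum>k\<le>n. apery_term n k)"
    by (simp add: apery_coeff_def apery_term_def atLeast0AtMost)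
  also have "\<dots> = (\<Sum>k\<le>m. apery_term n k)"
    using assms by (intro sum.mono_neutral_left) (auto simp: apery_term_eq_0)
  finally show ?thesis .
qed

lemma apery_coeff_recurrence:
  assumes "n > 0"
  shows "(real n + 1)^2 * real (apery_coeff (n + 1))
         = (11 * real n ^ 2 + 11 * real n + 3) * real (apery_coeff n)
           + real n ^ 2 * real (apery_coeff (n - 1))"
proof -
  define d where "d k = (real n + 1)^2 * apery_term (n + 1) k
           - (11 * real n ^ 2 + 11 * real n + 3) * apery_term n k
           - real n ^ 2 * apery_term (n - 1) k" for k
  \<comment> \<open>Partial sums of the telescoping identity. The base case holds because both sides
    equal \<open>- 11 * n^2 - 9 * n - 2\<close>.\<close>
  have d: "(\<Sum>k\<le>m. d k) = apery_cert n m" if "m \<le> n + 1" for m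
    using that
  proof (induction m)
    case 0
    show ?case
      by (simp add: d_def apery_cert_def apery_term_def algebra_simps power2_eq_square)
  next
    case (Suc m)
    thus ?case
      using apery_term_telescope[of n "Suc m"] assms by (simp add: d_def)
  qed
  \<comment> \<open>The certificate is a multiple of \<open>apery_term n (n + 1)\<close>, which is
    zero.\<close>
  have "(\<Sum>k\<le>n+1. d k) = 0"
    using d[of "n + 1"] by (simp add: apery_cert_def apery_term_eq_0)
  moreover have "(\<Sum>k\<le>n+1. d k) = (real n + 1)^2 * real (apery_coeff (n + 1))
         - (11 * real n ^ 2 + 11 * real n + 3) * real (apery_coeff n)
           - real n ^ 2 * real (apery_coeff (n - 1))"
    using assms
    by (simp only: d_def sum_subtractf sum_distrib_left apery_coeff_eq_sum[of "n + 1" "n + 1"]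
          apery_coeff_eq_sum[of n "n + 1"] apery_coeff_eq_sum[of "n - 1" "n + 1"] order_refl
          le_add1 diff_le_self trans_le_add1)
  ultimately show ?thesis by linarith
qed

section \<open>The differential equations of \<open>phi\<close> and of the hypergeometric
  series\<close>

text \<open>The squared binomial and the other binomial are each at most \<open>4 ^ n\<close>, and
  the number of summands is at most \<open>2 ^ n\<close>. Such a geometric bound makes the radius of
  convergence positive.\<close>

lemma apery_coeff_le: "apery_coeff n \<le> 32 ^ n"
proof -
  have "apery_coeff n \<le> (\<Sum>k=0..n. 16 ^ n)"
    unfolding apery_coeff_def
  proof (rule sum_mono)
    fix k assume "k \<in> {0..n}"
    hence "n + k \<le> 2 * n" by simp
    hence "n + k choose k \<le> 2 ^ (2 * n)"
      using binomial_le_pow2[of "n + k" k] power_increasing[of "n + k" "2 * n" "2 :: nat"]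
      by linarith
    moreover have "(n choose k) ^ 2 \<le> (2 ^ n) ^ 2"
      by (intro power_mono binomial_le_pow2) auto
    ultimately have "(n choose k) ^ 2 * (n + k choose k) \<le> (2 ^ n) ^ 2 * 2 ^ (2 * n)"
      by (rule mult_le_mono[rotated])
    also have "\<dots> = 16 ^ n"
      by (simp add: power_mult flip: power_mult_distrib power_even_eq)
    finally show "(n choose k) ^ 2 * (n + k choose k) \<le> 16 ^ n" .
  qed
  also have "\<dots> = (n + 1) * 16 ^ n" by simp
  also have "\<dots> \<le> 2 ^ n * 16 ^ n"
    by (intro mult_right_mono) (auto simp: Suc_leI)
  also have "\<dots> = 32 ^ n" by (simp flip: power_mult_distrib)
  finally show ?thesis .
qed

text \<open>Comparing coefficients of \<open>t ^ n\<close> gives \<open>(n+1) * ((n+1) * a (n+1) -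
  11 * n * a n - (n-1) * a (n-1)) = 3 * a n + a (n-1)\<close>, which is the recurrence
  rearranged.\<close>

lemma phi_sl_solution: "sl_solution (poly [:0, 1, -11, -1:]) (poly [:3, 1:]) phi"
proof -
  define F :: "complex fps" where "F = Abs_fps (\<lambda>n. of_nat (apery_coeff n))"
  have F_nth: "fps_nth F n = of_nat (apery_coeff n)" for n
    by (simp add: F_def)
  have "fps_conv_radius F > 0"
    unfolding F_def
  proof (rule fps_conv_radius_pos[of 32])
    show "norm (of_nat (apery_coeff n) :: complex) \<le> 32 ^ n" for n
      using of_nat_mono[OF apery_coeff_le[of n], where ?'a = real] by simp
  qed simp
  moreover have "fps_deriv (fps_of_poly [:0, 1, -11, -1:] * fps_deriv F) = fps_of_poly [:3, 1:] * F"
  proof (rule fps_ext)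
    fix n
    define G where "G = fps_deriv F"
    \<comment> \<open>With the powers of the variable written as nested factors
      \<open>fps_X\<close>, coefficients are read off by index shifts.\<close>
    have p: "fps_of_poly [:0, 1, -11, -1:] * G
               = fps_X * (G + fps_const (-11) * (fps_X * G) + fps_const (-1) * (fps_X * (fps_X * G)))"
      by (simp add: fps_of_poly_pCons algebra_simps)
    have q: "fps_of_poly [:3, 1:] * F = fps_const 3 * F + fps_X * F"
      by (simp add: fps_of_poly_pCons algebra_simps)
    show "fps_nth (fps_deriv (fps_of_poly [:0, 1, -11, -1:] * fps_deriv F)) n
            = fps_nth (fps_of_poly [:3, 1:] * F) n"
    \<comment> \<open>The recurrence starts at \<open>n = 1\<close>; the constant coefficient says
      that the first two Apery numbers are \<open>1\<close> and \<open>3\<close>.\<close>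
    proof (cases n)
      case 0
      thus ?thesis
        unfolding G_def[symmetric] p q
        by (simp add: G_def F_nth apery_coeff_def del: fps_deriv_mult)
    next
      case (Suc m)
      have "complex_of_real ((real n + 1)^2 * real (apery_coeff (n + 1)))
         = complex_of_real ((11 * real n ^ 2 + 11 * real n + 3) * real (apery_coeff n)
           + real n ^ 2 * real (apery_coeff (n - 1)))"
        using apery_coeff_recurrence[of n] Suc by simp
      thus ?thesis
        unfolding G_def[symmetric] p q
        by (cases m) (simp_all add: Suc G_def F_nth field_simps power2_eq_square del: fps_deriv_mult)
    qed
  qed
  ultimately have "sl_solution (poly [:0, 1, -11, -1:]) (poly [:3, 1:]) (eval_fps F)"
    by (rule sl_solution_eval_fps)
  also have "eval_fps F = phi"
    by (simp add: fun_eq_iff eval_fps_def phi_def F_nth)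
  finally show ?thesis .
qed

text \<open>The equation encodes the ratio \<open>(n + 1/4) * (n + 3/4) / (n + 1)^2\<close> of
  consecutive coefficients. This ratio is at most \<open>1\<close>, which also bounds all
  coefficients by \<open>1\<close>.\<close>

lemma hyp2F1_sl_solution:
  "sl_solution (poly [:0, 1, -1:]) (poly [:3/16:]) (hyp2F1 (1/4) (3/4) 1)"
proof -
  define a :: "nat \<Rightarrow> complex"
    where "a n = pochhammer (1/4) n * pochhammer (3/4) n / (pochhammer 1 n * fact n)" for n
  have rec: "(of_nat n + 1)^2 * a (Suc n) = (of_nat n + 1/4) * (of_nat n + 3/4) * a n" for n
  proof -
    have "a (Suc n) = (1/4 + of_nat n) * (3/4 + of_nat n) * a n / ((1 + of_nat n) * (1 + of_nat n))"
      unfolding a_def pochhammer_Suc fact_Suc by (simp add: ac_simps)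
    moreover have "1 + of_nat n \<noteq> (0 :: complex)"
      using of_nat_neq_0[of n, where ?'a = complex] by simp
    ultimately show ?thesis
      by (simp add: power2_eq_square add.commute)
  qed
  have le: "norm (a n) \<le> 1 ^ n" for n
  proof (induction n)
    case 0
    thus ?case by (simp add: a_def)
  next
    case (Suc n)
    have "(real n + 1)^2 * norm (a (Suc n)) = norm ((of_nat n + 1)^2 * a (Suc n))"
      unfolding norm_mult norm_power by (metis norm_of_nat of_nat_Suc add.commute)
    also have "\<dots> = norm (complex_of_real (real n + 1/4)) * norm (complex_of_real (real n + 3/4)) * norm (a n)"
      unfolding rec norm_mult by simp
    also have "\<dots> = (real n + 1/4) * (real n + 3/4) * norm (a n)"
      unfolding norm_of_real by simp
    also have "\<dots> \<le> (real n + 1) * (real n + 1) * 1"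
      using Suc.IH by (intro mult_mono) auto
    finally have "(real n + 1)^2 * norm (a (Suc n)) \<le> (real n + 1)^2 * 1"
      by (simp add: power2_eq_square)
    thus ?case by (subst (asm) mult_le_cancel_left_pos) auto
  qed
  define F where "F = Abs_fps a"
  have F_nth: "fps_nth F n = a n" for n
    by (simp add: F_def)
  have "fps_conv_radius F > 0"
    unfolding F_def using le by (rule fps_conv_radius_pos[rotated]) simp
  moreover have "fps_deriv (fps_of_poly [:0, 1, -1:] * fps_deriv F) = fps_of_poly [:3/16:] * F"
  proof (rule fps_ext)
    fix n
    define G where "G = fps_deriv F"
    have p: "fps_of_poly [:0, 1, -1:] * G = fps_X * (G + fps_const (-1) * (fps_X * G))"
      by (simp add: fps_of_poly_pCons algebra_simps)
    have q: "fps_of_poly [:3/16:] * F = fps_const (3/16) * F"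
      by (simp add: fps_of_poly_pCons)
    show "fps_nth (fps_deriv (fps_of_poly [:0, 1, -1:] * fps_deriv F)) n
            = fps_nth (fps_of_poly [:3/16:] * F) n"
      unfolding G_def[symmetric] p q using rec[of n]
      by (cases n) (simp_all add: G_def F_nth field_simps power2_eq_square del: fps_deriv_mult)
  qed
  ultimately have "sl_solution (poly [:0, 1, -1:]) (poly [:3/16:]) (eval_fps F)"
    by (rule sl_solution_eval_fps)
  also have "eval_fps F = hyp2F1 (1/4) (3/4) 1"
    by (simp add: fun_eq_iff eval_fps_def hyp2F1_def F_nth a_def)
  finally show ?thesis .
qed

section \<open>The common equation and its four solutions\<close>

definition ode_p :: "complex \<Rightarrow> complex" where
  "ode_p k = k * (1 - k^2) * (1 - 4 * k - k^2) * (1 + k - k^2)"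

definition ode_p' :: "complex \<Rightarrow> complex" where
  "ode_p' k = 1 - 6 * k - 21 * k^2 + 24 * k^3 + 35 * k^4 - 18 * k^5 - 7 * k^6"

text \<open>This is the polynomial that hypothesis \<open>Q\<close> of
  \<open>sl_solution_pullback\<close> dictates; all four substitutions produce the same one.\<close>

definition ode_q :: "complex \<Rightarrow> complex" where
  "ode_q k = 1 + 9 * k - 16 * k^2 - 30 * k^3 + 19 * k^4 + 9 * k^5"

lemma ode_p_has_field_derivative: "(ode_p has_field_derivative ode_p' k) (at k)"
  unfolding ode_p_def[abs_def] ode_p'_def
  by (rule derivative_eq_intros refl)+ (simp, algebra)

text \<open>For this argument \<open>t\<close>, \<open>1 - 11 * t - t^2\<close> equals
  \<open>(1 - 4*k - k^2)^2 * (1 + k - k^2) / (1 + k)^4\<close>, and the derivative of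
  \<open>t\<close> contains one factor \<open>1 - 4*k - k^2\<close>. Dividing it out leaves each
  factor of \<open>ode_p\<close> once.\<close>

lemma phi_pullback1:
  "sl_solution ode_p ode_q (\<lambda>k. 1 / (1 + k)^2 * phi (k * ((1 - k) / (1 + k))^2))"
proof -
  have ev: "\<forall>\<^sub>F k::complex in nhds 0. 1 + k \<noteq> 0"
    by (rule eventually_nhds_0_ne) auto
  define X' :: "complex \<Rightarrow> complex" where "X' = (\<lambda>k. (1 - k) * (1 - 4 * k - k^2) / (1 + k)^3)"
  define \<sigma> :: "complex \<Rightarrow> complex" where "\<sigma> = (\<lambda>k. - 2 / (1 + k))"
  define M :: "complex \<Rightarrow> complex"
    \<comment> \<open>A polynomial, since the factor \<open>1 + k\<close> of \<open>ode_p\<close>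
      cancels the denominator of \<open>\<sigma>\<close>.\<close>
    where "M = (\<lambda>k. - 2 * (1 - 8 * k - 9 * k^2 + 36 * k^3 - 10 * k^4 - 6 * k^5))"
  show ?thesis
  \<comment> \<open>In all four substitutions \<open>c\<close> is the order to which the new
    argument vanishes at \<open>0\<close>: compare leading terms in hypothesis \<open>P\<close>,
    where \<open>ode_p k\<close> behaves like \<open>k\<close>, \<open>p z\<close> like
    \<open>z\<close>, and \<open>s 0 = 1\<close>.\<close>
  proof (rule sl_solution_pullback[OF phi_sl_solution ev, where X' = X' and \<sigma> = \<sigma> and M = M and c = 1])
    fix k :: complex assume k: "1 + k \<noteq> 0"
    show "((\<lambda>k. k * ((1 - k) / (1 + k))^2) has_field_derivative X' k) (at k)"
      unfolding X'_def using k
      by (auto intro!: derivative_eq_intros simp: divide_simps) algebra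
    show "1 / (1 + k)^2 \<noteq> 0" using k by simp
    show "((\<lambda>k. 1 / (1 + k)^2) has_field_derivative \<sigma> k * (1 / (1 + k)^2)) (at k)"
      unfolding \<sigma>_def using k
      by (auto intro!: derivative_eq_intros simp: divide_simps) algebra
    show "((\<lambda>k. ode_p k * \<sigma> k) has_field_derivative M k) (at k)"
      unfolding \<sigma>_def M_def using k
      by (auto intro!: derivative_eq_intros ode_p_has_field_derivative
               simp: divide_simps ode_p_def ode_p'_def) algebra
    show "ode_p k * X' k * (1 / (1 + k)^2)^2
            = 1 * poly [:0, 1, -11, -1:] (k * ((1 - k) / (1 + k))^2)"
      unfolding X'_def ode_p_def using k by (simp add: divide_simps) algebra
    show "ode_q k = M k + ode_p k * \<sigma> k ^ 2
            + 1 * poly [:3, 1:] (k * ((1 - k) / (1 + k))^2) * X' k / (1 / (1 + k)^2)^2"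
      unfolding X'_def ode_p_def ode_q_def M_def \<sigma>_def using k by (simp add: divide_simps) algebra
  qed simp
qed

text \<open>The two quadratic factors exchange roles: here \<open>1 - 11 * t - t^2\<close> equals
  \<open>(1 - 4*k - k^2) * (1 + k - k^2)^2 / (1 - k)^2\<close>, and the derivative of
  \<open>t\<close> contains \<open>1 + k - k^2\<close>.\<close>

lemma phi_pullback2:
  "sl_solution ode_p ode_q (\<lambda>k. 1 / (1 - k) * phi (k^2 * (1 + k) / (1 - k)))"
proof -
  have ev: "\<forall>\<^sub>F k::complex in nhds 0. 1 - k \<noteq> 0"
    by (rule eventually_nhds_0_ne) auto
  define X' :: "complex \<Rightarrow> complex" where "X' = (\<lambda>k. 2 * k * (1 + k - k^2) / (1 - k)^2)"
  define \<sigma> :: "complex \<Rightarrow> complex" where "\<sigma> = (\<lambda>k. 1 / (1 - k))"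
  define M :: "complex \<Rightarrow> complex"
    where "M = (\<lambda>k. 1 - 4 * k - 27 * k^2 - 12 * k^3 + 20 * k^4 + 6 * k^5)"
  show ?thesis
  proof (rule sl_solution_pullback[OF phi_sl_solution ev, where X' = X' and \<sigma> = \<sigma> and M = M and c = 2])
    fix k :: complex assume k: "1 - k \<noteq> 0"
    show "((\<lambda>k. k^2 * (1 + k) / (1 - k)) has_field_derivative X' k) (at k)"
      unfolding X'_def using k
      by (auto intro!: derivative_eq_intros simp: divide_simps) algebra
    show "1 / (1 - k) \<noteq> 0" using k by simp
    show "((\<lambda>k. 1 / (1 - k)) has_field_derivative \<sigma> k * (1 / (1 - k))) (at k)"
      unfolding \<sigma>_def using k
      by (auto intro!: derivative_eq_intros simp: divide_simps)
    show "((\<lambda>k. ode_p k * \<sigma> k) has_field_derivative M k) (at k)"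
      unfolding \<sigma>_def M_def using k
      by (auto intro!: derivative_eq_intros ode_p_has_field_derivative
               simp: divide_simps ode_p_def ode_p'_def) algebra
    show "ode_p k * X' k * (1 / (1 - k))^2
            = 2 * poly [:0, 1, -11, -1:] (k^2 * (1 + k) / (1 - k))"
      unfolding X'_def ode_p_def using k by (simp add: divide_simps) algebra
    show "ode_q k = M k + ode_p k * \<sigma> k ^ 2
            + 2 * poly [:3, 1:] (k^2 * (1 + k) / (1 - k)) * X' k / (1 / (1 - k))^2"
      unfolding X'_def ode_p_def ode_q_def M_def \<sigma>_def using k by (simp add: divide_simps) algebra
  qed simp
qed

text \<open>Hypotheses \<open>P\<close> and \<open>Q\<close> are the conditions of
  \<open>sl_solution_pullback\<close> for the argument \<open>64 * v / D^2\<close> and the factor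
  \<open>1 / csqrt D\<close>, with denominators cleared. The root enters these conditions only
  through its square and its logarithmic derivative, so for polynomials \<open>D\<close> and
  \<open>v\<close> they are polynomial identities.\<close>

lemma hyp2F1_pullback:
  fixes D D' D'' v v' :: "complex \<Rightarrow> complex"
  assumes D: "\<And>k. (D has_field_derivative D' k) (at k)" "\<And>k. (D' has_field_derivative D'' k) (at k)"
  assumes v: "\<And>k. (v has_field_derivative v' k) (at k)"
  assumes 0: "D 0 = 1" "v 0 = 0"
  assumes P: "\<And>k. ode_p k * (v' k * D k - 2 * v k * D' k) = c * v k * (D k ^ 2 - 64 * v k)"
  assumes Q: "\<And>k. 4 * ode_q k * D k ^ 2 = 3 * ode_p k * D' k ^ 2
                   - 2 * (ode_p' k * D' k + ode_p k * D'' k) * D k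
                   + 48 * c * (v' k * D k - 2 * v k * D' k)"
  shows "sl_solution ode_p ode_q (\<lambda>k. 1 / csqrt (D k) * hyp2F1 (1/4) (3/4) 1 (64 * v k / D k ^ 2))"
proof -
  \<comment> \<open>Near \<open>0\<close> the values of \<open>D\<close> stay close to
    \<open>1\<close>, off the branch cut, where \<open>csqrt\<close> is differentiable and
    nonzero.\<close>
  have "filterlim D (nhds 1) (nhds 0)"
    using DERIV_isCont[OF D(1), of 0] 0(1) by (simp add: continuous_at tendsto_nhds_iff)
  moreover have "\<forall>\<^sub>F z in nhds 1. z \<in> - (\<real>\<^sub>\<le>\<^sub>0 :: complex set)"
    by (rule eventually_nhds_in_open) (auto simp: open_Compl)
  ultimately have ev: "\<forall>\<^sub>F k in nhds 0. D k \<notin> \<real>\<^sub>\<le>\<^sub>0"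
    by (auto dest: eventually_compose_filterlim)
  define X' :: "complex \<Rightarrow> complex" where "X' = (\<lambda>k. 64 * (v' k * D k - 2 * v k * D' k) / D k ^ 3)"
  define \<sigma> :: "complex \<Rightarrow> complex" where "\<sigma> = (\<lambda>k. - D' k / (2 * D k))"
  define M :: "complex \<Rightarrow> complex"
    where "M = (\<lambda>k. (ode_p k * D' k ^ 2 - (ode_p' k * D' k + ode_p k * D'' k) * D k) / (2 * D k ^ 2))"
  show ?thesis
  proof (rule sl_solution_pullback[OF hyp2F1_sl_solution ev, where X' = X' and \<sigma> = \<sigma> and M = M and c = c])
    fix k :: complex assume k': "D k \<notin> \<real>\<^sub>\<le>\<^sub>0"
    from k' have k: "D k \<noteq> 0" by auto
    have sq: "(1 / csqrt (D k))^2 = 1 / D k"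
      by (simp add: power_divide)
    show "((\<lambda>k. 64 * v k / D k ^ 2) has_field_derivative X' k) (at k)"
      unfolding X'_def using k
      by (auto intro!: derivative_eq_intros v D simp: divide_simps) algebra
    show "1 / csqrt (D k) \<noteq> 0" using k by simp
    have "csqrt (D k) * csqrt (D k) = D k" by (simp flip: power2_eq_square)
    thus "((\<lambda>k. 1 / csqrt (D k)) has_field_derivative \<sigma> k * (1 / csqrt (D k))) (at k)"
      unfolding \<sigma>_def using k k'
      by (auto intro!: derivative_eq_intros D simp: field_simps)
    show "((\<lambda>k. ode_p k * \<sigma> k) has_field_derivative M k) (at k)"
      unfolding \<sigma>_def M_def using k
      by (auto intro!: derivative_eq_intros ode_p_has_field_derivative D
               simp: divide_simps) algebra
    have "ode_p k * X' k * (1 / csqrt (D k))^2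
            = 64 * (ode_p k * (v' k * D k - 2 * v k * D' k)) / D k ^ 4"
      unfolding sq X'_def using k by (simp add: divide_simps) algebra
    also have "\<dots> = c * poly [:0, 1, -1:] (64 * v k / D k ^ 2)"
      unfolding P using k by (simp add: divide_simps)
    finally show "ode_p k * X' k * (1 / csqrt (D k))^2 = c * poly [:0, 1, -1:] (64 * v k / D k ^ 2)" .
    have "ode_q k = (4 * ode_q k * D k ^ 2) / (4 * D k ^ 2)"
      using k by simp
    also have "\<dots> = M k + ode_p k * \<sigma> k ^ 2 + c * poly [:3/16:] (64 * v k / D k ^ 2) * X' k / (1 / csqrt (D k))^2"
      unfolding Q sq M_def \<sigma>_def X'_def using k by (simp add: divide_simps) algebra
    finally show "ode_q k = M k + ode_p k * \<sigma> k ^ 2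
        + c * poly [:3/16:] (64 * v k / D k ^ 2) * X' k / (1 / csqrt (D k))^2" .
  qed (simp add: 0)
qed

lemma hyp2F1_pullback1:
  "sl_solution ode_p ode_q (\<lambda>k. 1 / csqrt ((1 + k^2) * ((1 - k - k^2)^2 - 5 * k^2))
     * hyp2F1 (1/4) (3/4) 1 (64 * (k^5 * (1 + k - k^2)) / ((1 + k^2) * ((1 - k - k^2)^2 - 5 * k^2))^2))"
\<comment> \<open>The argument starts with \<open>64 * k^5\<close>, hence \<open>c = 5\<close>; in
  the companion lemma it starts with \<open>64 * k\<close>, hence \<open>c = 1\<close>.\<close>
proof (rule hyp2F1_pullback[where c = 5 and
      D' = "\<lambda>k. - 2 - 10 * k - 20 * k^3 + 10 * k^4 + 6 * k^5" and
      D'' = "\<lambda>k. - 10 - 60 * k^2 + 40 * k^3 + 30 * k^4" and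
      v' = "\<lambda>k. 5 * k^4 + 6 * k^5 - 7 * k^6"])
  fix k :: complex
  show "((\<lambda>k. (1 + k^2) * ((1 - k - k^2)^2 - 5 * k^2)) has_field_derivative
          - 2 - 10 * k - 20 * k^3 + 10 * k^4 + 6 * k^5) (at k)"
    by (rule derivative_eq_intros refl)+ (simp, algebra)
  show "((\<lambda>k. - 2 - 10 * k - 20 * k^3 + 10 * k^4 + 6 * k^5) has_field_derivative
          - 10 - 60 * k^2 + 40 * k^3 + 30 * k^4) (at k)"
    by (rule derivative_eq_intros refl)+ simp
  show "((\<lambda>k. k^5 * (1 + k - k^2)) has_field_derivative 5 * k^4 + 6 * k^5 - 7 * k^6) (at k)"
    by (rule derivative_eq_intros refl)+ (simp, algebra)
qed (simp_all add: ode_p_def ode_p'_def ode_q_def, algebra+)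

lemma hyp2F1_pullback2:
  "sl_solution ode_p ode_q (\<lambda>k. 1 / csqrt ((1 + k^2) * ((1 + 11 * k - k^2)^2 - 125 * k^2))
     * hyp2F1 (1/4) (3/4) 1 (64 * (k * (1 + k - k^2)^5) / ((1 + k^2) * ((1 + 11 * k - k^2)^2 - 125 * k^2))^2))"
proof (rule hyp2F1_pullback[where c = 1 and
      D' = "\<lambda>k. 22 - 10 * k - 20 * k^3 - 110 * k^4 + 6 * k^5" and
      D'' = "\<lambda>k. - 10 - 60 * k^2 - 440 * k^3 + 30 * k^4" and
      v' = "\<lambda>k. (1 + k - k^2)^4 * (1 + 6 * k - 11 * k^2)"])
  fix k :: complex
  show "((\<lambda>k. (1 + k^2) * ((1 + 11 * k - k^2)^2 - 125 * k^2)) has_field_derivative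
          22 - 10 * k - 20 * k^3 - 110 * k^4 + 6 * k^5) (at k)"
    by (rule derivative_eq_intros refl)+ (simp, algebra)
  show "((\<lambda>k. 22 - 10 * k - 20 * k^3 - 110 * k^4 + 6 * k^5) has_field_derivative
          - 10 - 60 * k^2 - 440 * k^3 + 30 * k^4) (at k)"
    by (rule derivative_eq_intros refl)+ simp
  show "((\<lambda>k. k * (1 + k - k^2)^5) has_field_derivative
          (1 + k - k^2)^4 * (1 + 6 * k - 11 * k^2)) (at k)"
    by (rule derivative_eq_intros refl)+ (simp, algebra)
qed (simp_all add: ode_p_def ode_p'_def ode_q_def, algebra+)

section \<open>Comparison of the four solutions near \<open>0\<close>\<close>

theorem mainTheorem14:
  shows "\<exists>\<epsilon>>0. \<forall>k::complex. norm k < \<epsilon> \<longrightarrow>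
     phi (k * ((1 - k) / (1 + k))^2) =
       (1 + k)^2 / csqrt ((1 + k^2) * ((1 - k - k^2)^2 - 5 * k^2))
       * hyp2F1 (1/4) (3/4) 1
           (64 * k^5 * (1 + k - k^2) /
            ((1 + k^2)^2 * ((1 - k - k^2)^2 - 5 * k^2)^2))
   \<and> phi (k^2 * (1 + k) / (1 - k)) =
       (1 - k) / csqrt ((1 + k^2) * ((1 + 11 * k - k^2)^2 - 125 * k^2))
       * hyp2F1 (1/4) (3/4) 1
           (64 * k * (1 + k - k^2)^5 /
            ((1 + k^2)^2 * ((1 + 11 * k - k^2)^2 - 125 * k^2)^2))
   \<and> phi (k^2 * (1 + k) / (1 - k)) =
       (1 - k) / (1 + k)^2 * phi (k * ((1 - k) / (1 + k))^2)"
proof -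
  \<comment> \<open>The arguments \<open>x1\<close> and \<open>x2\<close> are grouped as
    \<open>64 * v / D^2\<close>, to fit the pullbacks; the grouping of the theorem is restored at
    the end.\<close>
  define t1 t2 x1 x2 s1 s2 :: "complex \<Rightarrow> complex" where
    "t1 = (\<lambda>k. k * ((1 - k) / (1 + k))^2)" and
    "t2 = (\<lambda>k. k^2 * (1 + k) / (1 - k))" and
    "x1 = (\<lambda>k. 64 * (k^5 * (1 + k - k^2)) / ((1 + k^2) * ((1 - k - k^2)^2 - 5 * k^2))^2)" and
    "x2 = (\<lambda>k. 64 * (k * (1 + k - k^2)^5) / ((1 + k^2) * ((1 + 11 * k - k^2)^2 - 125 * k^2))^2)" and
    "s1 = (\<lambda>k. csqrt ((1 + k^2) * ((1 - k - k^2)^2 - 5 * k^2)))" and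
    "s2 = (\<lambda>k. csqrt ((1 + k^2) * ((1 + 11 * k - k^2)^2 - 125 * k^2)))"
  note defs = t1_def t2_def x1_def x2_def s1_def s2_def
  define f where "f = hyp2F1 (1/4) (3/4) 1"
  have sol: "sl_solution ode_p ode_q (\<lambda>k. 1 / (1 + k)^2 * phi (t1 k))"
            "sl_solution ode_p ode_q (\<lambda>k. 1 / (1 - k) * phi (t2 k))"
            "sl_solution ode_p ode_q (\<lambda>k. 1 / s1 k * f (x1 k))"
            "sl_solution ode_p ode_q (\<lambda>k. 1 / s2 k * f (x2 k))"
    unfolding defs f_def
    by (rule phi_pullback1 phi_pullback2 hyp2F1_pullback1 hyp2F1_pullback2)+
  have "phi 0 = 1" "f 0 = 1"
    unfolding phi_def f_def hyp2F1_def powser_zero by (simp_all add: apery_coeff_def)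
  hence at_0: "phi (t1 0) = 1" "phi (t2 0) = 1" "f (x1 0) = 1" "f (x2 0) = 1" "s1 0 = 1" "s2 0 = 1"
    by (simp_all add: defs)
  have p: "ode_p 0 = 0" "\<forall>\<^sub>F k in at 0. ode_p k \<noteq> 0"
  proof -
    \<comment> \<open>The cofactor of \<open>k\<close> in \<open>ode_p\<close> equals
      \<open>1\<close> at \<open>0\<close>, so the zero there is isolated.\<close>
    have "\<forall>\<^sub>F k::complex in nhds 0. (1 - k^2) * (1 - 4 * k - k^2) * (1 + k - k^2) \<noteq> 0"
      by (rule eventually_nhds_0_ne) (auto intro!: continuous_intros)
    thus "\<forall>\<^sub>F k in at 0. ode_p k \<noteq> 0"
      unfolding eventually_at_filter by eventually_elim (auto simp: ode_p_def)
  qed (simp add: ode_p_def)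
  have "\<forall>\<^sub>F k in nhds 0. 1 / (1 + k)^2 * phi (t1 k) = 1 / s1 k * f (x1 k)"
       "\<forall>\<^sub>F k in nhds 0. 1 / (1 - k) * phi (t2 k) = 1 / s2 k * f (x2 k)"
       \<comment> \<open>The third identity compares the two solutions built from \<open>phi\<close>
         directly, with no use of the hypergeometric ones.\<close>
       "\<forall>\<^sub>F k in nhds 0. 1 / (1 - k) * phi (t2 k) = 1 / (1 + k)^2 * phi (t1 k)"
    using sol by (auto intro!: sl_solution_unique[OF _ _ p] simp: at_0)
  moreover have "\<forall>\<^sub>F k::complex in nhds 0. 1 + k \<noteq> 0" "\<forall>\<^sub>F k::complex in nhds 0. 1 - k \<noteq> 0"
    by (rule eventually_nhds_0_ne; simp)+
  ultimately have "\<forall>\<^sub>F k in nhds 0.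
      phi (t1 k) = (1 + k)^2 / s1 k * f (x1 k) \<and>
      phi (t2 k) = (1 - k) / s2 k * f (x2 k) \<and>
      phi (t2 k) = (1 - k) / (1 + k)^2 * phi (t1 k)"
  proof eventually_elim
    case (elim k)
    have *: "b = a * c" if "1 / a * b = c" "a \<noteq> 0" for a b c :: complex
      using that by auto
    show ?case
    proof (intro conjI)
      show "phi (t1 k) = (1 + k)^2 / s1 k * f (x1 k)"
        using *[OF elim(1)] elim(4) by simp
      show "phi (t2 k) = (1 - k) / s2 k * f (x2 k)"
        using *[OF elim(2)] elim(5) by simp
      show "phi (t2 k) = (1 - k) / (1 + k)^2 * phi (t1 k)"
        using *[OF elim(3)] elim(5) by simp
    qed
  qed
  thus ?thesis
    unfolding eventually_nhds_metric by (simp add: defs f_def power_mult_distrib mult.assoc)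
qed

end
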